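(* Let $\alpha$ and $\beta$ be left weak compositions. Then every term of $\alpha\ast\beta$ is a left weak composition and $$M_\alpha M_\beta=\phi(\alpha\ast\beta),$$ where $\phi:\mathbf{k}\,\mathrm{LWC}\to\mathbf{k}[[x_1,x_2,\ldots]]$ is the $\mathbf{k}$-linear map $\gamma\mapsto M_\gamma$. In other words, writing $\alpha\ast\beta=\sum_{\gamma\in(\alpha\ast\beta)}\gamma$ (a sum of left weak compositions, with multiplicity), $M_\alpha M_\beta=\sum_{\gamma\in(\alpha\ast\beta)}M_\gamma$.
   Context: $\mathbf{k}$ is a commutative unitary ring; $x_1,x_2,\ldots$ are commuting variables. A left weak composition is a finite nonempty sequence $(\alpha_1,\ldots,\alpha_k)$ of nonnegative integers with $\alpha_k>0$; $\mathrm{LWC}$ denotes the set of them and $\mathbf{k}\,\mathrm{LWC}$ the free $\mathbf{k}$-module on it. For $\alpha=(\alpha_1,\ldots,\alpha_k)\in\mathrm{LWC}$, $M_\alpha=\sum_{1\leq n_1<\cdots<n_k}x_{n_1}^{\alpha_1}\cdots x_{n_k}^{\alpha_k}$. The quasi-shuffle product $\ast$ on the free $\mathbf{k}$-module spanned by finite sequences of nonnegative integers (including the empty sequence $()$) is the bilinear product defined recursively by $()\ast\alpha=\alpha\ast()=\alpha$ and, for $\alpha=(\alpha_1,\ldots,\alpha_m)$, $\beta=(\beta_1,\ldots,\beta_n)$ with $m,n\geq1$, $$\alpha\ast\beta=(\alpha_1,(\alpha_2,\ldots,\alpha_m)\ast\beta)+(\beta_1,\alpha\ast(\beta_2,\ldots,\beta_n))+(\alpha_1+\beta_1,(\alpha_2,\ldots,\alpha_m)\ast(\beta_2,\ldots,\beta_n)),$$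 where $(c,\sum_i\gamma_i)$ means $\sum_i(c,\gamma_i)$, i.e. $c$ is prepended to each sequence. *)

theory Defs
  imports "HOL-Library.Poly_Mapping" "HOL-Library.Multiset"
begin

text \<open>
  Throughout, the coefficient ring is of sort \<open>{comm_ring, comm_monoid_mult}\<close>: an arbitrary
  commutative ring with unit. The class \<open>comm_ring_1\<close> would in addition exclude the zero ring.
\<close>

section \<open>Formal power series in countably many commuting variables\<close>

text \<open>
  A monomial is its finitely supported exponent vector, and a power series is an arbitrary
  function from monomials to coefficients. Variables are indexed from \<open>0\<close>, so index \<open>i\<close>
  stands for $x_{i+1}$.
\<close>

typedef 'a pseries = "UNIV :: ((nat \<Rightarrow>\<^sub>0 nat) \<Rightarrow> 'a) set"
  morphisms coeff Abs_pseries ..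

setup_lifting type_definition_pseries

lemma pseries_eqI: "(\<And>m. coeff f m = coeff g m) \<Longrightarrow> f = g"
  by transfer auto

definition splits :: "(nat \<Rightarrow>\<^sub>0 nat) \<Rightarrow> ((nat \<Rightarrow>\<^sub>0 nat) \<times> (nat \<Rightarrow>\<^sub>0 nat)) set" where
  "splits m = {(a, b). a + b = m}"

lemma finite_splits: "finite (splits m)"
proof -
  let ?K = "Poly_Mapping.keys m" and ?B = "Max (Poly_Mapping.lookup m ` Poly_Mapping.keys m)"
  let ?F = "{f. \<forall>x. (x \<in> ?K \<longrightarrow> f x \<in> {..?B}) \<and> (x \<notin> ?K \<longrightarrow> f x = 0)}"
  have "Poly_Mapping.lookup (fst p) \<in> ?F" if "p \<in> splits m" for p
  proof -
    have "fst p + snd p = m"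
      using that by (simp add: splits_def split_beta)
    have le: "Poly_Mapping.lookup (fst p) x \<le> Poly_Mapping.lookup m x" for x
      by (simp flip: \<open>fst p + snd p = m\<close> add: lookup_add)
    have max: "Poly_Mapping.lookup m x \<le> ?B" if "x \<in> ?K" for x
      using that by (intro Max_ge) auto
    have zero: "Poly_Mapping.lookup m x = 0" if "x \<notin> ?K" for x
      using that by (simp add: in_keys_iff)
    show ?thesis
    proof (intro CollectI allI conjI impI)
      fix x
      show "Poly_Mapping.lookup (fst p) x \<in> {..?B}" if "x \<in> ?K"
        using le_trans[OF le max[OF that]] by simp
      show "Poly_Mapping.lookup (fst p) x = 0" if "x \<notin> ?K"
        using le[of x] zero[OF that] by simp
    qed
  qed
  then have "(\<lambda>p. Poly_Mapping.lookup (fst p)) ` splits m \<subseteq> ?F"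
    by (rule image_subsetI)
  moreover have "finite ?F"
    by (intro finite_set_of_finite_funs) auto
  ultimately have "finite ((\<lambda>p. Poly_Mapping.lookup (fst p)) ` splits m)"
    by (rule finite_subset)
  moreover have "inj_on (\<lambda>p. Poly_Mapping.lookup (fst p)) (splits m)"
  proof (rule inj_onI)
    fix p q
    assume pq: "p \<in> splits m" "q \<in> splits m"
      and "Poly_Mapping.lookup (fst p) = Poly_Mapping.lookup (fst q)"
    then have fst: "fst p = fst q"
      by (simp only: lookup_inject)
    have "fst p + snd p = fst q + snd q"
      using pq by (simp add: splits_def split_beta)
    with fst show "p = q"
      by (simp add: prod_eq_iff)
  qed
  ultimately show ?thesis
    by (rule finite_imageD)
qed

instantiation pseries :: (comm_ring) comm_ring
begin

lift_definition zero_pseries :: "'a pseries" is "\<lambda>m. 0" .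

lift_definition plus_pseries :: "'a pseries \<Rightarrow> 'a pseries \<Rightarrow> 'a pseries"
  is "\<lambda>f g m. f m + g m" .

lift_definition uminus_pseries :: "'a pseries \<Rightarrow> 'a pseries" is "\<lambda>f m. - f m" .

lift_definition minus_pseries :: "'a pseries \<Rightarrow> 'a pseries \<Rightarrow> 'a pseries"
  is "\<lambda>f g m. f m - g m" .

lift_definition times_pseries :: "'a pseries \<Rightarrow> 'a pseries \<Rightarrow> 'a pseries"
  is "\<lambda>f g m. \<Sum>(a, b) \<in> splits m. f a * g b" .

instance
proof
  fix f g h :: "'a pseries"
  show "f * g * h = f * (g * h)"
  proof (rule pseries_eqI)
    fix m
    have "coeff (f * g * h) m =
        (\<Sum>p\<in>splits m. \<Sum>q\<in>splits (fst p). coeff f (fst q) * coeff g (snd q) * coeff h (snd p))"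
      by (simp add: times_pseries.rep_eq case_prod_beta sum_distrib_right)
    also have "\<dots> = (\<Sum>(p, q)\<in>Sigma (splits m) (\<lambda>p. splits (fst p)).
        coeff f (fst q) * coeff g (snd q) * coeff h (snd p))"
      by (subst sum.Sigma) (auto simp: finite_splits)
    also have "\<dots> = (\<Sum>(p, q)\<in>Sigma (splits m) (\<lambda>p. splits (snd p)).
        coeff f (fst p) * (coeff g (fst q) * coeff h (snd q)))"
      by (rule sum.reindex_bij_witness[where
            i = "\<lambda>((a, bc), (b, c)). ((a + b, c), (a, b))" and
            j = "\<lambda>((ab, c), (a, b)). ((a, b + c), (b, c))"])
        (auto simp: splits_def add.assoc mult.assoc)
    also have "\<dots> = (\<Sum>p\<in>splits m. \<Sum>q\<in>splits (snd p).
        coeff f (fst p) * (coeff g (fst q) * coeff h (snd q)))"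
      by (subst sum.Sigma) (auto simp: finite_splits)
    also have "\<dots> = coeff (f * (g * h)) m"
      by (simp add: times_pseries.rep_eq case_prod_beta sum_distrib_left)
    finally show "coeff (f * g * h) m = coeff (f * (g * h)) m" .
  qed
  show "f * g = g * f"
  proof (rule pseries_eqI)
    fix m
    show "coeff (f * g) m = coeff (g * f) m"
      unfolding times_pseries.rep_eq
      by (rule sum.reindex_bij_witness[where i = prod.swap and j = prod.swap])
        (auto simp: splits_def add.commute mult.commute)
  qed
  show "(f + g) * h = f * h + g * h"
    by (rule pseries_eqI)
      (simp add: times_pseries.rep_eq plus_pseries.rep_eq case_prod_beta distrib_right sum.distrib)
  show "f + g + h = f + (g + h)"
    by (rule pseries_eqI) (simp add: plus_pseries.rep_eq add.assoc)
  show "f + g = g + f"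
    by (rule pseries_eqI) (simp add: plus_pseries.rep_eq add.commute)
  show "0 + f = f"
    by (rule pseries_eqI) (simp add: plus_pseries.rep_eq zero_pseries.rep_eq)
  show "- f + f = 0"
    by (rule pseries_eqI) (simp add: plus_pseries.rep_eq uminus_pseries.rep_eq zero_pseries.rep_eq)
  show "f - g = f + - g"
    by (rule pseries_eqI) (simp add: plus_pseries.rep_eq minus_pseries.rep_eq uminus_pseries.rep_eq)
qed

end

instantiation pseries :: ("{comm_ring, comm_monoid_mult}") comm_monoid_mult
begin

lift_definition one_pseries :: "'a pseries" is "\<lambda>m. if m = 0 then 1 else 0" .

instance
proof
  fix f :: "'a pseries"
  show "1 * f = f"
  proof (rule pseries_eqI)
    fix m
    have "coeff (1 * f) m = (\<Sum>p\<in>{(0 :: nat \<Rightarrow>\<^sub>0 nat, m)}. (if fst p = 0 then 1 else 0) * coeff f (snd p))"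
      unfolding times_pseries.rep_eq one_pseries.rep_eq case_prod_beta
      by (rule sum.mono_neutral_right) (simp_all add: finite_splits, auto simp: splits_def)
    then show "coeff (1 * f) m = coeff f m" by simp
  qed
qed

end

lift_definition scale :: "'a::comm_ring \<Rightarrow> 'a pseries \<Rightarrow> 'a pseries"
  is "\<lambda>c f m. c * f m" .

lift_definition var :: "nat \<Rightarrow> 'a::{comm_ring, comm_monoid_mult} pseries"
  is "\<lambda>i m. if m = Poly_Mapping.single i 1 then 1 else 0" .

text \<open>
  The formal sum of a possibly infinite family of power series, taken coefficientwise. It is
  meaningful if each monomial has a nonzero coefficient in only finitely many members.
\<close>

lift_definition formal_sum :: "('i \<Rightarrow> 'a pseries) \<Rightarrow> 'i set \<Rightarrow> 'a::comm_ring pseries"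
  is "\<lambda>f I m. \<Sum>i | i \<in> I \<and> f i m \<noteq> 0. f i m" .

section \<open>Left weak compositions and the series \<open>M\<close>\<close>

definition LWC :: "nat list set" where
  "LWC = {\<alpha>. \<alpha> \<noteq> [] \<and> last \<alpha> > 0}"

text \<open>
  For \<open>\<alpha> \<in> LWC\<close> the family below is formally summable: the last entry of \<open>\<alpha>\<close> being positive,
  a monomial bounds the last index, hence all indices.
\<close>

definition M :: "nat list \<Rightarrow> 'a::{comm_ring, comm_monoid_mult} pseries" where
  "M \<alpha> = formal_sum (\<lambda>ns. \<Prod>i<length \<alpha>. var (ns ! i) ^ (\<alpha> ! i))
           {ns. length ns = length \<alpha> \<and> sorted_wrt (<) ns}"

section \<open>The quasi-shuffle product\<close>

text \<open>
  The free module on all finite sequences of nonnegative integers is \<open>nat list \<Rightarrow>\<^sub>0 'a\<close>.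
\<close>

abbreviation basis :: "nat list \<Rightarrow> (nat list \<Rightarrow>\<^sub>0 'a::{comm_ring, comm_monoid_mult})" where
  "basis \<gamma> \<equiv> Poly_Mapping.single \<gamma> 1"

definition free_LWC :: "(nat list \<Rightarrow>\<^sub>0 'a::{comm_ring, comm_monoid_mult}) set" where
  "free_LWC = {f. Poly_Mapping.keys f \<subseteq> LWC}"

definition prepend ::
  "nat \<Rightarrow> (nat list \<Rightarrow>\<^sub>0 'a) \<Rightarrow> (nat list \<Rightarrow>\<^sub>0 'a::{comm_ring, comm_monoid_mult})" where
  "prepend c f = (\<Sum>\<gamma>\<in>Poly_Mapping.keys f. Poly_Mapping.single (c # \<gamma>) (Poly_Mapping.lookup f \<gamma>))"

fun qsh :: "nat list \<Rightarrow> nat list \<Rightarrow> (nat list \<Rightarrow>\<^sub>0 'a::{comm_ring, comm_monoid_mult})" where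
  "qsh [] \<beta> = basis \<beta>"
| "qsh (a # \<alpha>) [] = basis (a # \<alpha>)"
| "qsh (a # \<alpha>) (b # \<beta>) =
     prepend a (qsh \<alpha> (b # \<beta>)) + prepend b (qsh (a # \<alpha>) \<beta>) + prepend (a + b) (qsh \<alpha> \<beta>)"

definition quasi_shuffle :: "(nat list \<Rightarrow>\<^sub>0 'a) \<Rightarrow> (nat list \<Rightarrow>\<^sub>0 'a) \<Rightarrow>
    (nat list \<Rightarrow>\<^sub>0 'a::{comm_ring, comm_monoid_mult})"  (infixl \<open>\<star>\<close> 70) where
  "f \<star> g = (\<Sum>\<alpha>\<in>Poly_Mapping.keys f. \<Sum>\<beta>\<in>Poly_Mapping.keys g.
     Poly_Mapping.map ((*) (Poly_Mapping.lookup f \<alpha> * Poly_Mapping.lookup g \<beta>)) (qsh \<alpha> \<beta>))"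

text \<open>
  The terms of \<open>basis \<alpha> \<star> basis \<beta>\<close>, listed with multiplicity by the same recursion. Unlike
  the coefficients in \<open>'a\<close>, these multiplicities cannot vanish in positive characteristic.
\<close>

fun qsh_terms :: "nat list \<Rightarrow> nat list \<Rightarrow> nat list multiset" where
  "qsh_terms [] \<beta> = {#\<beta>#}"
| "qsh_terms (a # \<alpha>) [] = {#a # \<alpha>#}"
| "qsh_terms (a # \<alpha>) (b # \<beta>) =
     image_mset ((#) a) (qsh_terms \<alpha> (b # \<beta>)) + image_mset ((#) b) (qsh_terms (a # \<alpha>) \<beta>)
     + image_mset ((#) (a + b)) (qsh_terms \<alpha> \<beta>)"

text \<open>
  The linear map with \<open>basis \<gamma> \<mapsto> M \<gamma>\<close>. Only its values on \<open>free_LWC\<close> are meaningful, as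
  \<open>M \<gamma>\<close> need not be a legitimate formal sum for other \<open>\<gamma>\<close>.
\<close>

definition phi :: "(nat list \<Rightarrow>\<^sub>0 'a) \<Rightarrow> 'a::{comm_ring, comm_monoid_mult} pseries" where
  "phi f = (\<Sum>\<gamma>\<in>Poly_Mapping.keys f. scale (Poly_Mapping.lookup f \<gamma>) (M \<gamma>))"

lemma scale_simps:
  "scale 0 s = 0" "scale c 0 = 0" "scale 1 t = t" "scale (a + b) s = scale a s + scale b s"
  "scale c (s + s') = scale c s + scale c s'" "scale (a * b) s = scale a (scale b s)"
  for s s' :: "'a::comm_ring pseries" and t :: "'b::{comm_ring, comm_monoid_mult} pseries"
  by (simp_all add: pseries_eqI scale.rep_eq zero_pseries.rep_eq plus_pseries.rep_eq
      distrib_left distrib_right mult.assoc)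

lemma scale_sum: "scale c (\<Sum>x\<in>A. F x) = (\<Sum>x\<in>A. scale c (F x))"
  by (induction A rule: infinite_finite_induct) (simp_all add: scale_simps)

lemma phi_superset:
  "finite A \<Longrightarrow> Poly_Mapping.keys f \<subseteq> A \<Longrightarrow>
    phi f = (\<Sum>\<gamma>\<in>A. scale (Poly_Mapping.lookup f \<gamma>) (M \<gamma>))"
  unfolding phi_def by (rule sum.mono_neutral_left) (auto simp: in_keys_iff scale_simps)

lemma phi_basis: "phi (basis \<gamma>) = M \<gamma>"
  by (subst phi_superset[where A = "{\<gamma>}"]) (simp_all add: scale_simps)

lemma phi_add: "phi (f + g) = phi f + phi g"
  using keys_add[of f g]
  by (simp add: phi_superset[of "Poly_Mapping.keys f \<union> Poly_Mapping.keys g"] lookup_add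
      scale_simps sum.distrib)

lemma phi_scale: "phi (Poly_Mapping.map ((*) c) f) = scale c (phi f)"
proof -
  have lookup: "Poly_Mapping.lookup (Poly_Mapping.map ((*) c) f) \<gamma> = c * Poly_Mapping.lookup f \<gamma>" for \<gamma>
    by (simp add: map.rep_eq when_def)
  then have "Poly_Mapping.keys (Poly_Mapping.map ((*) c) f) \<subseteq> Poly_Mapping.keys f"
    by (auto simp: in_keys_iff)
  then show ?thesis
    by (simp add: phi_superset[of "Poly_Mapping.keys f"] lookup scale_sum scale_simps)
qed

end

theory Submission
  imports Defs
begin

text \<open>
  Only finitely many variables \<open>x\<^sub>0, \<dots>, x\<^bsub>K-1\<^esub>\<close> occur in a given monomial, and since the last entry of
  a left weak composition is positive, the coefficient of that monomial in \<open>M \<alpha>\<close> can be read off the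
  truncation of \<open>M \<alpha>\<close> to these variables. The truncation is a polynomial \<open>T xs \<alpha>\<close> in the list \<open>xs\<close>
  of variables, and it satisfies a recursion according to whether the first variable is used:
  \<open>T (x # xs) (a # \<alpha>) = x ^ a * T xs \<alpha> + T xs (a # \<alpha>)\<close>. Multiplying two such expressions gives
  \<open>T xs (a # \<alpha>) * T xs (b # \<beta>)\<close> and three further products which mirror the three summands of the
  quasi-shuffle recursion, so the truncated product formula follows by induction on the list; it
  holds for all weak compositions, not only the left ones.
\<close>

section \<open>Truncated series and their product formula\<close>

fun trunc_M :: "'a::{comm_ring, comm_monoid_mult} list \<Rightarrow> nat list \<Rightarrow> 'a" where
  "trunc_M xs [] = 1"
| "trunc_M [] (a # \<alpha>) = 0"
| "trunc_M (x # xs) (a # \<alpha>) = x ^ a * trunc_M xs \<alpha> + trunc_M xs (a # \<alpha>)"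

lemma qsh_terms_Nil_right [simp]: "qsh_terms \<alpha> [] = {#\<alpha>#}"
  by (cases \<alpha>) simp_all

text \<open>A prepended entry becomes the last one exactly when the tail is empty; this controls
  that case in \<open>qsh_terms_LWC\<close>.\<close>

lemma Nil_in_qsh_terms_iff: "[] \<in># qsh_terms \<alpha> \<beta> \<longleftrightarrow> \<alpha> = [] \<and> \<beta> = []"
  by (induction \<alpha> \<beta> rule: qsh_terms.induct) auto

lemma trunc_M_mult:
  "trunc_M xs \<alpha> * trunc_M xs \<beta> = (\<Sum>\<gamma> \<in># qsh_terms \<alpha> \<beta>. trunc_M xs \<gamma>)"
proof (induction xs arbitrary: \<alpha> \<beta>)
  case Nil
  show ?case
    by (cases \<alpha>; cases \<beta>) (simp_all add: multiset.map_comp comp_def)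
next
  case (Cons x xs)
  show ?case
  proof (cases "\<alpha> = [] \<or> \<beta> = []")
    case True
    then show ?thesis by auto
  next
    case False
    then obtain a \<alpha>' b \<beta>' where ab: "\<alpha> = a # \<alpha>'" "\<beta> = b # \<beta>'"
      by (meson neq_Nil_conv)
    \<comment> \<open>Separates the part that uses \<open>x\<close> from the part that avoids it,
      for all terms with first entry \<open>c\<close>; applied with \<open>c\<close> equal to
      \<open>a\<close>, \<open>b\<close> and \<open>a + b\<close>.\<close>
    have head: "(\<Sum>\<gamma> \<in># A. trunc_M (x # xs) (c # \<gamma>))
        = x ^ c * (\<Sum>\<gamma> \<in># A. trunc_M xs \<gamma>) + (\<Sum>\<gamma> \<in># A. trunc_M xs (c # \<gamma>))" for c A
      by (induction A) (simp_all add: algebra_simps)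
    have "trunc_M (x # xs) \<alpha> * trunc_M (x # xs) \<beta> =
        x ^ a * (trunc_M xs \<alpha>' * trunc_M xs \<beta>) + x ^ b * (trunc_M xs \<alpha> * trunc_M xs \<beta>')
        + x ^ (a + b) * (trunc_M xs \<alpha>' * trunc_M xs \<beta>') + trunc_M xs \<alpha> * trunc_M xs \<beta>"
      by (simp add: ab algebra_simps power_add)
    \<comment> \<open>By the induction hypothesis the last product supplies the parts avoiding
      \<open>x\<close> for all three kinds of terms; the other three products supply the parts using
      \<open>x\<close>.\<close>
    also have "\<dots> = (\<Sum>\<gamma> \<in># qsh_terms \<alpha> \<beta>. trunc_M (x # xs) \<gamma>)"
      unfolding Cons.IH
      by (simp add: ab multiset.map_comp comp_def head algebra_simps del: trunc_M.simps)
    finally show ?thesis .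
  qed
qed

section \<open>Reading off coefficients of \<open>M\<close> from truncations\<close>

definition index_lists :: "nat \<Rightarrow> nat \<Rightarrow> nat \<Rightarrow> nat list set" where
  "index_lists l h k = {ns. length ns = k \<and> sorted_wrt (<) ns \<and> set ns \<subseteq> {l..<h}}"

lemma finite_index_lists: "finite (index_lists l h k)"
  by (rule finite_subset[OF _ finite_lists_length_eq[of "{l..<h}" k]]) (auto simp: index_lists_def)

lemma index_lists_0: "index_lists l h 0 = {[]}"
  by (auto simp: index_lists_def)

lemma index_lists_empty: "h \<le> l \<Longrightarrow> index_lists l h (Suc k) = {}"
  by (auto simp: index_lists_def)

text \<open>The smallest admissible index \<open>l\<close> is either the head of an increasing list
  or absent from it.\<close>

lemma index_lists_Suc:
  assumes "l < h"
  shows "index_lists l h (Suc k) = (#) l ` index_lists (Suc l) h k \<union> index_lists (Suc l) h (Suc k)"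
    (is "?L = ?R")
proof
  show "?L \<subseteq> ?R"
  proof
    fix ns assume "ns \<in> ?L"
    then obtain n ms where ns: "ns = n # ms" "length ms = k" "sorted_wrt (<) ms"
        "\<forall>i\<in>set ms. n < i" "l \<le> n" "n < h" "set ms \<subseteq> {l..<h}"
      by (auto simp: index_lists_def length_Suc_conv)
    show "ns \<in> ?R"
    proof (cases "n = l")
      case True
      with ns have "ms \<in> index_lists (Suc l) h k"
        by (auto simp: index_lists_def subset_eq Suc_le_eq)
      with True ns show ?thesis by blast
    next
      case False
      with ns have "Suc l \<le> i" if "i \<in> set ns" for i
        using that by force
      with ns have "ns \<in> index_lists (Suc l) h (Suc k)"
        by (auto simp: index_lists_def subset_eq)
      then show ?thesis by blast
    qed
  qed
  show "?R \<subseteq> ?L"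
    using assms by (auto simp: index_lists_def Suc_le_eq subset_eq less_imp_le)
qed

text \<open>Induction on the number of variables: the case split in \<open>index_lists_Suc\<close>
  matches the recursion of \<open>trunc_M\<close>.\<close>

lemma trunc_M_eq_sum:
  "trunc_M (map x [l..<h]) \<alpha>
    = (\<Sum>ns\<in>index_lists l h (length \<alpha>). \<Prod>i<length \<alpha>. x (ns ! i) ^ (\<alpha> ! i))"
proof (induction "h - l" arbitrary: l \<alpha>)
  case 0
  then show ?case
    by (cases \<alpha>) (simp_all add: index_lists_0 index_lists_empty)
next
  case (Suc n)
  then have lh: "l < h" and n: "n = h - Suc l" by auto
  show ?case
  proof (cases \<alpha>)
    case Nil
    then show ?thesis by (simp add: index_lists_0)
  next
    case (Cons a \<alpha>')
    let ?f = "\<lambda>ns. \<Prod>i<length \<alpha>. x (ns ! i) ^ (\<alpha> ! i)"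
    have "(\<Sum>ns\<in>index_lists l h (length \<alpha>). ?f ns)
        = (\<Sum>ns\<in>(#) l ` index_lists (Suc l) h (length \<alpha>'). ?f ns)
          + (\<Sum>ns\<in>index_lists (Suc l) h (length \<alpha>). ?f ns)"
      unfolding Cons list.size(4) add_Suc_right add_0_right index_lists_Suc[OF lh]
      by (rule sum.union_disjoint) (auto simp: finite_index_lists, auto simp: index_lists_def)
    also have "(\<Sum>ns\<in>(#) l ` index_lists (Suc l) h (length \<alpha>'). ?f ns)
        = (\<Sum>ns\<in>index_lists (Suc l) h (length \<alpha>'). x l ^ a * (\<Prod>i<length \<alpha>'. x (ns ! i) ^ (\<alpha>' ! i)))"
      by (subst sum.reindex) (auto simp: Cons prod.lessThan_Suc_shift simp del: prod.lessThan_Suc)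
    also have "\<dots> = x l ^ a * trunc_M (map x [Suc l..<h]) \<alpha>'"
      by (simp only: Suc.hyps(1)[OF n] sum_distrib_left)
    also have "(\<Sum>ns\<in>index_lists (Suc l) h (length \<alpha>). ?f ns) = trunc_M (map x [Suc l..<h]) \<alpha>"
      by (simp only: Suc.hyps(1)[OF n])
    finally show ?thesis
      using lh by (simp add: Cons upt_conv_Cons)
  qed
qed

lemma coeff_sum: "coeff (\<Sum>i\<in>I. f i) m = (\<Sum>i\<in>I. coeff (f i) m)"
  by (induction I rule: infinite_finite_induct)
    (simp_all add: zero_pseries.rep_eq plus_pseries.rep_eq)

lemma coeff_sum_mset: "coeff (\<Sum>i\<in>#I. f i) m = (\<Sum>i\<in>#I. coeff (f i) m)"
  by (induction I) (simp_all add: zero_pseries.rep_eq plus_pseries.rep_eq)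

text \<open>Some splitting of \<open>m\<close> has the monomial of \<open>var i\<close> as its first
  part, and natural exponents cannot cancel.\<close>

lemma coeff_var_mult_nonzero:
  assumes "coeff (var i * f) m \<noteq> 0"
  shows "i \<in> Poly_Mapping.keys m"
proof -
  obtain p where p: "p \<in> splits m" "coeff (var i) (fst p) * coeff f (snd p) \<noteq> 0"
    using assms unfolding times_pseries.rep_eq case_prod_beta
    by (rule sum.not_neutral_contains_not_neutral)
  have "fst p = Poly_Mapping.single i 1"
    using p(2) by (auto simp: var.rep_eq split: if_splits)
  moreover have "m = fst p + snd p"
    using p(1) by (simp add: splits_def split_beta)
  ultimately show ?thesis
    by (simp add: in_keys_iff lookup_add)
qed

text \<open>The last exponent is positive, so a summand contributes at \<open>m\<close> only if its
  last, hence largest, index occurs in \<open>m\<close> and so lies below \<open>K\<close>.\<close>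

lemma coeff_M:
  assumes \<alpha>: "\<alpha> \<in> LWC" and m: "Poly_Mapping.keys m \<subseteq> {..<K}"
  shows "coeff (M \<alpha> :: 'a::{comm_ring, comm_monoid_mult} pseries) m
    = coeff (trunc_M (map var [0..<K]) \<alpha>) m"
proof -
  let ?f = "\<lambda>ns. \<Prod>i<length \<alpha>. (var (ns ! i) :: 'a pseries) ^ (\<alpha> ! i)"
  let ?I = "{ns. length ns = length \<alpha> \<and> sorted_wrt (<) ns}"
  have bound: "ns \<in> index_lists 0 K (length \<alpha>)"
    if ns: "length ns = length \<alpha>" "sorted_wrt (<) ns" and nz: "coeff (?f ns) m \<noteq> 0" for ns
  proof -
    define k where "k = length \<alpha> - 1"
    have k: "k < length \<alpha>" "length \<alpha> = Suc k" "\<alpha> ! k > 0"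
      using \<alpha> by (auto simp: LWC_def k_def last_conv_nth)
    then obtain p where "\<alpha> ! k = Suc p"
      using gr0_implies_Suc by blast
    \<comment> \<open>One copy of the last variable is split off to apply
      \<open>coeff_var_mult_nonzero\<close>.\<close>
    then have f: "?f ns = var (ns ! k) * (var (ns ! k) ^ p * (\<Prod>i<k. var (ns ! i) ^ (\<alpha> ! i)))"
      using k by (simp add: mult_ac)
    have "ns ! k \<in> Poly_Mapping.keys m"
      using nz unfolding f by (rule coeff_var_mult_nonzero)
    with m have "ns ! k < K" by auto
    moreover have "ns ! i \<le> ns ! k" if "i < length ns" for i
      using that ns k sorted_wrt_nth_less[OF ns(2), of i k] by (cases "i = k") auto
    ultimately show ?thesis
      using ns by (force simp: index_lists_def in_set_conv_nth)
  qed
  have "coeff (M \<alpha> :: 'a pseries) m = (\<Sum>ns | ns \<in> ?I \<and> coeff (?f ns) m \<noteq> 0. coeff (?f ns) m)"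
    by (simp only: M_def formal_sum.rep_eq)
  also have "\<dots> = (\<Sum>ns\<in>index_lists 0 K (length \<alpha>). coeff (?f ns) m)"
    by (rule sum.mono_neutral_left[OF finite_index_lists])
      (use bound in \<open>auto simp: index_lists_def\<close>)
  finally show ?thesis
    by (simp add: trunc_M_eq_sum coeff_sum)
qed

lemma qsh_terms_LWC:
  assumes "\<alpha> \<in> LWC" "\<beta> \<in> LWC" "\<gamma> \<in># qsh_terms \<alpha> \<beta>"
  shows "\<gamma> \<in> LWC"
proof -
  have "\<alpha> \<in> insert [] LWC \<Longrightarrow> \<beta> \<in> insert [] LWC \<Longrightarrow> \<gamma> \<in># qsh_terms \<alpha> \<beta> \<Longrightarrow> \<gamma> \<in> insert [] LWC"
  proof (induction \<alpha> \<beta> arbitrary: \<gamma> rule: qsh_terms.induct)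
    case (3 a \<alpha> b \<beta>)
    have tail: "\<delta> \<in> insert [] LWC" if "c # \<delta> \<in> insert [] LWC" for c \<delta>
      using that by (auto simp: LWC_def split: if_splits)
    have cons: "c # \<delta> \<in> LWC" if "\<delta> \<in> insert [] LWC" "\<delta> = [] \<Longrightarrow> c > 0" for c \<delta>
      using that by (auto simp: LWC_def)
    have \<alpha>: "\<alpha> \<in> insert [] LWC" and \<beta>: "\<beta> \<in> insert [] LWC"
      using 3 tail by blast+
    \<comment> \<open>Here \<open>a\<close> is the last entry of the first argument; this makes
      \<open>[a + b]\<close> a left weak composition.\<close>
    have a: "a > 0" if "\<alpha> = []" using 3 that by (auto simp: LWC_def)
    from 3(6) consider
        \<delta> where "\<gamma> = a # \<delta>" "\<delta> \<in># qsh_terms \<alpha> (b # \<beta>)"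
      | \<delta> where "\<gamma> = b # \<delta>" "\<delta> \<in># qsh_terms (a # \<alpha>) \<beta>"
      | \<delta> where "\<gamma> = (a + b) # \<delta>" "\<delta> \<in># qsh_terms \<alpha> \<beta>"
      by auto
    then show ?case
    proof cases
      case 1
      with 3 \<alpha> Nil_in_qsh_terms_iff[of \<alpha> "b # \<beta>"] show ?thesis
        using cons by blast
    next
      case 2
      with 3 \<beta> Nil_in_qsh_terms_iff[of "a # \<alpha>" \<beta>] show ?thesis
        using cons by blast
    next
      case 3
      with "3.IH"(3)[OF \<alpha> \<beta>] a Nil_in_qsh_terms_iff[of \<alpha> \<beta>] cons show ?thesis
        by (metis add_gr_0 insertI2)
    qed
  qed simp_all
  moreover have "\<gamma> \<noteq> []"
    using assms Nil_in_qsh_terms_iff by (auto simp: LWC_def)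
  ultimately show ?thesis using assms by blast
qed

lemma M_mult:
  assumes "\<alpha> \<in> LWC" "\<beta> \<in> LWC"
  shows "(M \<alpha> * M \<beta> :: 'a::{comm_ring, comm_monoid_mult} pseries) = (\<Sum>\<gamma> \<in># qsh_terms \<alpha> \<beta>. M \<gamma>)"
proof (rule pseries_eqI)
  fix m :: "nat \<Rightarrow>\<^sub>0 nat"
  have "finite (Poly_Mapping.keys m)"
    by (rule finite_keys)
  then obtain K where "\<forall>i\<in>Poly_Mapping.keys m. i < K"
    unfolding finite_nat_set_iff_bounded ..
  then have K: "Poly_Mapping.keys m \<subseteq> {..<K}"
    by auto
  let ?T = "trunc_M (map var [0..<K]) :: nat list \<Rightarrow> 'a pseries"
  \<comment> \<open>Exponents add without cancellation, so both parts of a splitting use only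
    variables of \<open>m\<close>, and one \<open>K\<close> serves the whole convolution.\<close>
  have keys: "Poly_Mapping.keys a \<subseteq> {..<K}" "Poly_Mapping.keys b \<subseteq> {..<K}"
    if "(a, b) \<in> splits m" for a b
  proof -
    have "a + b = m" using that by (simp add: splits_def)
    then have "Poly_Mapping.keys a \<subseteq> Poly_Mapping.keys m" "Poly_Mapping.keys b \<subseteq> Poly_Mapping.keys m"
      by (auto simp: in_keys_iff lookup_add)
    with K show "Poly_Mapping.keys a \<subseteq> {..<K}" "Poly_Mapping.keys b \<subseteq> {..<K}" by auto
  qed
  have "coeff (M \<alpha> * M \<beta> :: 'a pseries) m = coeff (?T \<alpha> * ?T \<beta>) m"
    unfolding times_pseries.rep_eq
    by (rule sum.cong) (auto simp: assms coeff_M[where K = K] keys)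
  also have "\<dots> = (\<Sum>\<gamma> \<in># qsh_terms \<alpha> \<beta>. coeff (?T \<gamma>) m)"
    by (simp only: trunc_M_mult coeff_sum_mset)
  \<comment> \<open>\<open>coeff_M\<close> applies to every term because the terms are left weak
    compositions.\<close>
  also have "\<dots> = (\<Sum>\<gamma> \<in># qsh_terms \<alpha> \<beta>. coeff (M \<gamma>) m)"
    using qsh_terms_LWC[OF assms]
    by (intro arg_cong[where f = sum_mset] image_mset_cong) (simp add: coeff_M[OF _ K])
  finally show "coeff (M \<alpha> * M \<beta> :: 'a pseries) m = coeff (\<Sum>\<gamma> \<in># qsh_terms \<alpha> \<beta>. M \<gamma>) m"
    by (simp only: coeff_sum_mset)
qed

section \<open>Passage from multisets of terms to the free module\<close>

lemma prepend_superset: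
  "finite A \<Longrightarrow> Poly_Mapping.keys f \<subseteq> A \<Longrightarrow>
    prepend c f = (\<Sum>\<gamma>\<in>A. Poly_Mapping.single (c # \<gamma>) (Poly_Mapping.lookup f \<gamma>))"
  unfolding prepend_def by (rule sum.mono_neutral_left) (auto simp: in_keys_iff)

lemma prepend_add: "prepend c (f + g) = prepend c f + prepend c g"
  using keys_add[of f g]
  by (simp add: prepend_superset[of "Poly_Mapping.keys f \<union> Poly_Mapping.keys g"] lookup_add
      single_add sum.distrib)

lemma prepend_sum_basis:
  "prepend c (\<Sum>\<gamma> \<in># A. basis \<gamma>) = (\<Sum>\<gamma> \<in># A. basis (c # \<gamma>))"
proof (induction A)
  case empty
  show ?case by (simp add: prepend_def)
next
  case (add \<gamma> A)
  have "prepend c (basis \<gamma>) = basis (c # \<gamma>)"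
    by (subst prepend_superset[where A = "{\<gamma>}"]) simp_all
  with add show ?case by (simp add: prepend_add)
qed

lemma qsh_eq_sum_basis: "qsh \<alpha> \<beta> = (\<Sum>\<gamma> \<in># qsh_terms \<alpha> \<beta>. basis \<gamma>)"
  by (induction \<alpha> \<beta> rule: qsh_terms.induct)
    (simp_all add: prepend_sum_basis multiset.map_comp comp_def)

lemma quasi_shuffle_basis:
  "(basis \<alpha> \<star> basis \<beta> :: nat list \<Rightarrow>\<^sub>0 'a::{comm_ring, comm_monoid_mult}) = qsh \<alpha> \<beta>"
proof (cases "(1::'a) = 0")
  \<comment> \<open>In the zero ring \<open>basis\<close> has no keys, so the double sum does not
    reduce to one summand; but then all module elements coincide.\<close>
  case True
  then have "x = 0" for x :: 'a
    by (metis mult_1 mult_zero_left)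
  then have "f = g" for f g :: "nat list \<Rightarrow>\<^sub>0 'a"
    by (intro poly_mapping_eqI) metis
  then show ?thesis .
next
  case False
  have "Poly_Mapping.map ((*) 1) f = f" for f :: "nat list \<Rightarrow>\<^sub>0 'a"
    by (rule poly_mapping_eqI) (simp add: map.rep_eq when_def)
  with False show ?thesis
    by (simp add: quasi_shuffle_def)
qed

text \<open>The inclusion can be strict, since a multiplicity may vanish in the coefficient
  ring.\<close>

lemma keys_sum_basis: "Poly_Mapping.keys (\<Sum>\<gamma> \<in># A. basis \<gamma>) \<subseteq> set_mset A"
proof (induction A)
  case (add \<gamma> A)
  then show ?case
    using keys_add[of "basis \<gamma>" "\<Sum>\<gamma> \<in># A. basis \<gamma>"] by (auto split: if_splits)
qed simp

lemma phi_sum_basis: "phi (\<Sum>\<gamma> \<in># A. basis \<gamma>) = (\<Sum>\<gamma> \<in># A. M \<gamma>)"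
proof (induction A)
  case empty
  show ?case by (simp add: phi_def)
qed (simp add: phi_add phi_basis)

theorem theorem3p7:
  fixes \<alpha> \<beta> :: "nat list"
  assumes "\<alpha> \<in> LWC" and "\<beta> \<in> LWC"
  shows "(\<forall>\<gamma> \<in># qsh_terms \<alpha> \<beta>. \<gamma> \<in> LWC)
    \<and> (basis \<alpha> \<star> basis \<beta> :: nat list \<Rightarrow>\<^sub>0 'a::{comm_ring, comm_monoid_mult})
        = (\<Sum>\<gamma> \<in># qsh_terms \<alpha> \<beta>. basis \<gamma>)
    \<and> (basis \<alpha> \<star> basis \<beta> :: nat list \<Rightarrow>\<^sub>0 'a) \<in> free_LWC
    \<and> (M \<alpha> * M \<beta> :: 'a pseries) = phi (basis \<alpha> \<star> basis \<beta>)
    \<and> (M \<alpha> * M \<beta> :: 'a pseries) = (\<Sum>\<gamma> \<in># qsh_terms \<alpha> \<beta>. M \<gamma>)"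
proof -
  have "(\<Sum>\<gamma> \<in># qsh_terms \<alpha> \<beta>. basis \<gamma> :: nat list \<Rightarrow>\<^sub>0 'a) \<in> free_LWC"
    using keys_sum_basis qsh_terms_LWC[OF assms] by (fastforce simp: free_LWC_def)
  then show ?thesis
    using qsh_terms_LWC[OF assms]
    by (simp add: quasi_shuffle_basis qsh_eq_sum_basis phi_sum_basis M_mult[OF assms])
qed

end
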